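(* Let $\mathbb{F}_q$ be a finite field with $q\equiv 1\pmod 3$. There are exactly $(2q+4)/3$ isomorphism classes (over $\mathbb{F}_q$) of elliptic curves $E$ over $\mathbb{F}_q$ whose group $E(\mathbb{F}_q)[3]$ of rational $3$-torsion points is cyclic of order $3$. Let $b_0\in\mathbb{F}_q$ be a non-cube and $\rho\in\mathbb{F}_q$ a primitive cube root of unity. A family of representatives of these classes is given by the curves $$y^2+m_a\,xy+b_0^i\,y=x^3,\qquad i\in\{0,1,2\},\ a\in\mathbb{F}_q,\ a^3-27b_0^i \text{ not a cube in } \mathbb{F}_q,$$ where $m_a=\min\{a,\rho a,\rho^2a\}$ with respect to a fixed total order on $\mathbb{F}_q$ (so that $m_a$ is a chosen representative of $\{a,\rho a,\rho^2 a\}$).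
   Context: Here $0$ counts as a cube, so the condition that $a^3-27b_0^i$ is not a cube includes $a^3\ne 27b_0^i$, i.e. nonsingularity of the curve. *)

theory Defs
  imports
    Complex_Main
    "HOL-Algebra.Elementary_Groups"
    "HOL-Computational_Algebra.Nth_Powers"
    "HOL-Number_Theory.Cong"
begin

(* Weierstrass a1 a2 a3 a4 a6 is the curve
   y^2 + a1 x y + a3 y = x^3 + a2 x^2 + a4 x + a6.
   General Weierstrass equations are needed because characteristic 2 is allowed. *)
datatype 'a weierstrass = Weierstrass 'a 'a 'a 'a 'a

fun discriminant :: "'a::field weierstrass \<Rightarrow> 'a" where
  "discriminant (Weierstrass a1 a2 a3 a4 a6) =
     (let b2 = a1^2 + 4 * a2;
          b4 = 2 * a4 + a1 * a3;
          b6 = a3^2 + 4 * a6;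
          b8 = a1^2 * a6 + 4 * a2 * a6 - a1 * a3 * a4 + a2 * a3^2 - a4^2
      in - (b2^2 * b8) - 8 * b4^3 - 27 * b6^2 + 9 * b2 * b4 * b6)"

definition elliptic_curve :: "'a::field weierstrass \<Rightarrow> bool" where
  "elliptic_curve E \<longleftrightarrow> discriminant E \<noteq> 0"

datatype 'a point = Infinity | Affine 'a 'a

fun on_curve :: "'a::field weierstrass \<Rightarrow> 'a point \<Rightarrow> bool" where
  "on_curve E Infinity \<longleftrightarrow> True"
| "on_curve (Weierstrass a1 a2 a3 a4 a6) (Affine x y) \<longleftrightarrow>
     y^2 + a1 * x * y + a3 * y = x^3 + a2 * x^2 + a4 * x + a6"

(* Chord-tangent addition with neutral element Infinity; the negative of (x, y) is
   (x, - y - a1 x - a3), and l is the slope of the chord or tangent. *)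
fun point_add :: "'a::field weierstrass \<Rightarrow> 'a point \<Rightarrow> 'a point \<Rightarrow> 'a point" where
  "point_add E Infinity Q = Q"
| "point_add E P Infinity = P"
| "point_add (Weierstrass a1 a2 a3 a4 a6) (Affine x1 y1) (Affine x2 y2) =
     (if x1 = x2 \<and> y2 = - y1 - a1 * x1 - a3 then Infinity
      else
        let l = (if x1 = x2
                 then (3 * x1^2 + 2 * a2 * x1 + a4 - a1 * y1) / (2 * y1 + a1 * x1 + a3)
                 else (y2 - y1) / (x2 - x1));
            x3 = l^2 + a1 * l - a2 - x1 - x2
        in Affine x3 (- (l * (x3 - x1) + y1) - a1 * x3 - a3))"

definition point_group :: "'a::field weierstrass \<Rightarrow> 'a point monoid" where
  "point_group E = \<lparr>carrier = {P. on_curve E P}, monoid.mult = point_add E, one = Infinity\<rparr>"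

definition torsion_group :: "nat \<Rightarrow> 'a::field weierstrass \<Rightarrow> 'a point monoid" where
  "torsion_group n E = (point_group E)
     \<lparr>carrier := {P \<in> carrier (point_group E).
        P [^]\<^bsub>point_group E\<^esub> n = \<one>\<^bsub>point_group E\<^esub>}\<rparr>"

(* Admissible change of variables x = u^2 x' + r, y = u^3 y' + s u^2 x' + t over the base field. *)
fun isomorphic_curves :: "'a::field weierstrass \<Rightarrow> 'a weierstrass \<Rightarrow> bool" where
  "isomorphic_curves (Weierstrass a1 a2 a3 a4 a6) (Weierstrass a1' a2' a3' a4' a6') \<longleftrightarrow>
     (\<exists>u r s t. u \<noteq> 0 \<and>
        u * a1' = a1 + 2 * s \<and>
        u^2 * a2' = a2 - s * a1 + 3 * r - s^2 \<and>
        u^3 * a3' = a3 + r * a1 + 2 * t \<and>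
        u^4 * a4' = a4 - s * a3 + 2 * r * a2 - (t + r * s) * a1 + 3 * r^2 - 2 * s * t \<and>
        u^6 * a6' = a6 + r * a4 + r^2 * a2 + r^3 - t * a3 - t^2 - r * t * a1)"

definition cyclic_3_torsion_curves :: "'a::field weierstrass set" where
  "cyclic_3_torsion_curves =
     {E. elliptic_curve E \<and> cyclic_group (torsion_group 3 E) \<and> order (torsion_group 3 E) = 3}"

definition isomorphism_classes :: "'a::field weierstrass set \<Rightarrow> 'a weierstrass set set" where
  "isomorphism_classes S = S // {(E, E'). E \<in> S \<and> E' \<in> S \<and> isomorphic_curves E E'}"

definition family_of_representatives :: "'a set \<Rightarrow> 'a set set \<Rightarrow> bool" where
  "family_of_representatives R \<C> \<longleftrightarrow> R \<subseteq> \<Union>\<C> \<and> (\<forall>C\<in>\<C>. \<exists>!E. E \<in> R \<and> E \<in> C)"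

definition primitive_root_of_unity :: "nat \<Rightarrow> 'a::field \<Rightarrow> bool" where
  "primitive_root_of_unity n z \<longleftrightarrow> z ^ n = 1 \<and> (\<forall>k\<in>{1..<n}. z ^ k \<noteq> 1)"

(* The relation r is meant to be a linear order: (x, y) \<in> r reads x \<le> y. *)
definition min_wrt :: "'a rel \<Rightarrow> 'a set \<Rightarrow> 'a" where
  "min_wrt r A = (THE m. m \<in> A \<and> (\<forall>x\<in>A. (m, x) \<in> r))"

end

theory Submission
  imports "HOL-Computational_Algebra.Polynomial" "HOL-Number_Theory.Residues" Defs
begin

text \<open>A curve with a rational point of order three is moved, by sending that point to the origin
  and its flex tangent to the \<open>x\<close>-axis, to the Deuring form \<open>y\<^sup>2 + a x y + b y = x\<^sup>3\<close>.
  The roots \<open>x \<noteq> 0\<close> of the 3-division polynomial of the latter correspond to the cube roots of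
  \<open>a\<^sup>3 - 27 b\<close>, and since \<open>- 3 = (2 \<omega> + 1)\<^sup>2\<close> is a square the points above them are rational.
  So the rational 3-torsion has order three exactly when \<open>a\<^sup>3 - 27 b\<close> is not a cube. In that case
  an isomorphism of Deuring forms maps the origin to one of the two points of order three, which
  leaves only the scalings \<open>(a, b) \<mapsto> (u a, u\<^sup>3 b)\<close>; it remains to find transversals for them.\<close>

section \<open>Changes of coordinates\<close>

text \<open>The parameters are arguments here, so that composites and inverses can be tracked and
  later read as points and slopes. The condition \<open>u \<noteq> 0\<close> is imposed
  separately.\<close>

fun coord_change :: "'a::field \<Rightarrow> 'a \<Rightarrow> 'a \<Rightarrow> 'a \<Rightarrow> 'a weierstrass \<Rightarrow> 'a weierstrass \<Rightarrow> bool" where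
  "coord_change u r s t (Weierstrass a1 a2 a3 a4 a6) (Weierstrass a1' a2' a3' a4' a6') \<longleftrightarrow>
     u * a1' = a1 + 2 * s \<and>
     u^2 * a2' = a2 - s * a1 + 3 * r - s^2 \<and>
     u^3 * a3' = a3 + r * a1 + 2 * t \<and>
     u^4 * a4' = a4 - s * a3 + 2 * r * a2 - (t + r * s) * a1 + 3 * r^2 - 2 * s * t \<and>
     u^6 * a6' = a6 + r * a4 + r^2 * a2 + r^3 - t * a3 - t^2 - r * t * a1"

abbreviation deuring :: "'a::field \<Rightarrow> 'a \<Rightarrow> 'a weierstrass" where
  "deuring a b \<equiv> Weierstrass a 0 b 0 0"

lemma isomorphic_curves_iff_coord_change:
  "isomorphic_curves E E' \<longleftrightarrow> (\<exists>u r s t. u \<noteq> 0 \<and> coord_change u r s t E E')"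
  by (cases E; cases E') simp

lemma coord_change_refl: "coord_change 1 0 0 0 E E"
  by (cases E) simp

text \<open>Solving for the new coordinates gives \<open>x' = v^2 * (x - r)\<close> and
  \<open>y' = v^3 * (y - s * (x - r) - t)\<close>; expanding yields the parameters.\<close>

lemma coord_change_sym:
  assumes "u * v = 1" "coord_change u r s t E E'"
  shows "coord_change v (- (v^2 * r)) (- (v * s)) (v^3 * (r * s - t)) E' E"
proof -
  obtain a1 a2 a3 a4 a6 where E: "E = Weierstrass a1 a2 a3 a4 a6" by (cases E)
  obtain b1 b2 b3 b4 b6 where E': "E' = Weierstrass b1 b2 b3 b4 b6" by (cases E')
  have inv: "b = v^n * c" if "u^n * b = c" for b c n
    using assms(1) that[symmetric] by (simp add: mult_ac flip: power_mult_distrib)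
  have b1: "b1 = v * (a1 + 2 * s)"
    using inv[of 1 b1 "a1 + 2 * s"] assms(2) unfolding E E' by simp
  have b2: "b2 = v^2 * (a2 - s * a1 + 3 * r - s^2)"
    and b3: "b3 = v^3 * (a3 + r * a1 + 2 * t)"
    and b4: "b4 = v^4 * (a4 - s * a3 + 2 * r * a2 - (t + r * s) * a1 + 3 * r^2 - 2 * s * t)"
    and b6: "b6 = v^6 * (a6 + r * a4 + r^2 * a2 + r^3 - t * a3 - t^2 - r * t * a1)"
    using assms(2) by (auto intro!: inv simp: E E')
  show ?thesis
    unfolding E E' b1 b2 b3 b4 b6 coord_change.simps
    by (intro conjI; simp add: power_numeral_reduce algebra_simps)
qed

text \<open>The parameters come from substituting one change of variables into the other and
  collecting powers of \<open>u * v\<close>.\<close>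

lemma coord_change_trans:
  assumes "coord_change u r s t E E'" "coord_change v r' s' t' E' E''"
  shows "coord_change (u * v) (u^2 * r' + r) (u * s' + s) (u^3 * t' + s * u^2 * r' + t) E E''"
proof -
  obtain a1 a2 a3 a4 a6 where E: "E = Weierstrass a1 a2 a3 a4 a6" by (cases E)
  obtain b1 b2 b3 b4 b6 where E': "E' = Weierstrass b1 b2 b3 b4 b6" by (cases E')
  obtain c1 c2 c3 c4 c6 where E'': "E'' = Weierstrass c1 c2 c3 c4 c6" by (cases E'')
  have a1: "a1 = u * b1 - 2 * s"
    and a2: "a2 = u^2 * b2 + s * a1 - 3 * r + s^2"
    and a3: "a3 = u^3 * b3 - r * a1 - 2 * t"
    and a4: "a4 = u^4 * b4 + s * a3 - 2 * r * a2 + (t + r * s) * a1 - 3 * r^2 + 2 * s * t"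
    and a6: "a6 = u^6 * b6 - r * a4 - r^2 * a2 - r^3 + t * a3 + t^2 + r * t * a1"
    using assms(1) by (simp_all add: E E')
  have c: "v * c1 = b1 + 2 * s'"
    "v^2 * c2 = b2 - s' * b1 + 3 * r' - s'^2"
    "v^3 * c3 = b3 + r' * b1 + 2 * t'"
    "v^4 * c4 = b4 - s' * b3 + 2 * r' * b2 - (t' + r' * s') * b1 + 3 * r'^2 - 2 * s' * t'"
    "v^6 * c6 = b6 + r' * b4 + r'^2 * b2 + r'^3 - t' * b3 - t'^2 - r' * t' * b1"
    using assms(2) by (simp_all add: E' E'')
  show ?thesis
    unfolding E E'' coord_change.simps power_mult_distrib mult.assoc c
    \<comment> \<open>The equations are triangular, so every coefficient of \<open>E\<close> can be
      eliminated in favour of those of \<open>E'\<close>.\<close>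
    unfolding a6 a4 a3 a2 a1
    by (intro conjI; simp add: power_numeral_reduce algebra_simps)
qed

lemma isomorphic_curves_refl: "isomorphic_curves E E"
  unfolding isomorphic_curves_iff_coord_change using coord_change_refl one_neq_zero by blast

lemma isomorphic_curves_sym: "isomorphic_curves E E' \<Longrightarrow> isomorphic_curves E' E"
  unfolding isomorphic_curves_iff_coord_change 
  by (metis coord_change_sym mult_zero_right right_inverse zero_neq_one)

lemma isomorphic_curves_trans:
  "isomorphic_curves E E' \<Longrightarrow> isomorphic_curves E' E'' \<Longrightarrow> isomorphic_curves E E''"
  unfolding isomorphic_curves_iff_coord_change by (metis coord_change_trans mult_eq_0_iff)

lemma equiv_isomorphic_curves:
  "equiv S {(E, E'). E \<in> S \<and> E' \<in> S \<and> isomorphic_curves E E'}"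
  by (intro equivI refl_onI symI transI)
     (auto intro: isomorphic_curves_refl isomorphic_curves_sym isomorphic_curves_trans)

text \<open>Vanishing coefficients are insensitive to \<open>u\<close>, so the whole scaling can be
  absorbed into \<open>a\<close> and \<open>b\<close>.\<close>

lemma coord_change_deuring_scale:
  "coord_change u r s t E (deuring a b) \<longleftrightarrow> coord_change 1 r s t E (deuring (u * a) (u^3 * b))"
  by (cases E) simp

text \<open>In terms of the auxiliary quantities \<open>B2\<close>, \<open>B4\<close>,
  \<open>B6\<close>, \<open>B8\<close> the parameters \<open>s\<close> and \<open>t\<close> drop
  out, which keeps the final identity small.\<close>

lemma discriminant_coord_change_1:
  assumes "coord_change 1 r s t E E'"
  shows "discriminant E' = discriminant E"
proof -
  obtain a1 a2 a3 a4 a6 where E: "E = Weierstrass a1 a2 a3 a4 a6" by (cases E)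
  obtain b1 b2 b3 b4 b6 where E': "E' = Weierstrass b1 b2 b3 b4 b6" by (cases E')
  have b1: "b1 = a1 + 2 * s"
    and b2: "b2 = a2 - s * a1 + 3 * r - s^2"
    and b3: "b3 = a3 + r * a1 + 2 * t"
    and b4: "b4 = a4 - s * a3 + 2 * r * a2 - (t + r * s) * a1 + 3 * r^2 - 2 * s * t"
    and b6: "b6 = a6 + r * a4 + r^2 * a2 + r^3 - t * a3 - t^2 - r * t * a1"
    using assms by (simp_all add: E E')
  define B2 B4 B6 B8 where
    B: "B2 = a1^2 + 4 * a2" "B4 = 2 * a4 + a1 * a3" "B6 = a3^2 + 4 * a6"
       "B8 = a1^2 * a6 + 4 * a2 * a6 - a1 * a3 * a4 + a2 * a3^2 - a4^2"
  have B2: "b1^2 + 4 * b2 = B2 + 12 * r"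
    unfolding B b1 b2 by (simp add: power_numeral_reduce algebra_simps)
  have B4: "2 * b4 + b1 * b3 = B4 + r * B2 + 6 * r^2"
    unfolding B b1 b3 b4 by (simp add: power_numeral_reduce algebra_simps)
  have B6: "b3^2 + 4 * b6 = B6 + 2 * r * B4 + r^2 * B2 + 4 * r^3"
    unfolding B b3 b6 by (simp add: power_numeral_reduce algebra_simps)
  have B8: "b1^2 * b6 + 4 * b2 * b6 - b1 * b3 * b4 + b2 * b3^2 - b4^2
     = B8 + 3 * r * B6 + 3 * r^2 * B4 + r^3 * B2 + 3 * r^4"
    unfolding B b1 b2 b3 b4 b6 by (simp add: power_numeral_reduce algebra_simps)
  have rel: "4 * B8 = B2 * B6 - B4^2"
    unfolding B by (simp add: power_numeral_reduce algebra_simps)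
  \<comment> \<open>With \<open>B2\<close>, \<open>B4\<close>, \<open>B6\<close>, \<open>B8\<close>
    treated as independent, the discriminants agree only up to a multiple of \<open>rel\<close>. In
    characteristic 2 that relation cannot be solved for \<open>B8\<close>, so it is used as a
    vanishing factor.\<close>
  have "discriminant E' - discriminant E = (6 * r * B2 + 36 * r^2) * (B2 * B6 - B4^2 - 4 * B8)"
    unfolding E E' discriminant.simps Let_def B2 B4 B6 B8 B[symmetric]
    by (simp add: power_numeral_reduce algebra_simps)
  then show ?thesis
    using rel by simp
qed

section \<open>Points of order three\<close>

text \<open>The affine points of order three are the flexes: those for which a change of coordinates
  with \<open>u = 1\<close> moves the point to the origin and its tangent to the \<open>x\<close>-axis so that a Deuring
  form results. The parameters \<open>r\<close>, \<open>s\<close>, \<open>t\<close> of such a change are the coordinates \<open>x\<close>, \<open>y\<close> of the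
  point (\<open>r\<close> and \<open>t\<close>) and the slope of the tangent (\<open>s\<close>). In this form the notion is visibly
  invariant under isomorphism.\<close>

definition flex :: "'a::field weierstrass \<Rightarrow> 'a \<Rightarrow> 'a \<Rightarrow> bool" where
  "flex E x y \<longleftrightarrow> (\<exists>l a b. b \<noteq> 0 \<and> coord_change 1 x l y E (deuring a b))"

text \<open>The vanishing of the new \<open>a6\<close>, \<open>a4\<close> and \<open>a2\<close> says
  in turn that the point lies on the curve, that \<open>l\<close> is its tangent slope, and that the
  tangent meets the curve only there. The new \<open>a3\<close> is nonzero when the point is not its
  own negative. The form matches the doubling formula.\<close>

lemma flex_Weierstrass:
  "flex (Weierstrass a1 a2 a3 a4 a6) x y \<longleftrightarrow>
     on_curve (Weierstrass a1 a2 a3 a4 a6) (Affine x y) \<and> 2 * y + a1 * x + a3 \<noteq> 0 \<and>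
     (\<exists>l. l * (2 * y + a1 * x + a3) = 3 * x^2 + 2 * a2 * x + a4 - a1 * y \<and>
          l^2 + a1 * l - a2 - x - x = x)"
proof -
  have 1: "0 = a6 + x * a4 + x^2 * a2 + x^3 - y * a3 - y^2 - x * y * a1 \<longleftrightarrow>
     on_curve (Weierstrass a1 a2 a3 a4 a6) (Affine x y)"
    unfolding on_curve.simps by (rule diff_eq_diff_eq) (simp add: algebra_simps)
  have 2: "0 = a4 - l * a3 + 2 * x * a2 - (y + x * l) * a1 + 3 * x^2 - 2 * l * y \<longleftrightarrow>
     l * (2 * y + a1 * x + a3) = 3 * x^2 + 2 * a2 * x + a4 - a1 * y" for l
    by (rule diff_eq_diff_eq) (simp add: algebra_simps)
  have 3: "0 = a2 - l * a1 + 3 * x - l^2 \<longleftrightarrow> l^2 + a1 * l - a2 - x - x = x" for l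
    by (rule diff_eq_diff_eq) (simp add: algebra_simps)
  have 4: "a3 + x * a1 + 2 * y = 2 * y + a1 * x + a3"
    by (simp add: algebra_simps)
  show ?thesis
    by (simp only: flex_def coord_change.simps mult_1 power_one mult_zero_right 1 2 3 4) blast
qed

text \<open>An affine \<open>P\<close> satisfies \<open>(P + P) + P = Infinity\<close> exactly when
  its double is its negative, that is, when the tangent at \<open>P\<close> is not vertical and the
  double has the same abscissa.\<close>

lemma carrier_torsion_group_3:
  "carrier (torsion_group 3 (E :: 'a::field weierstrass)) = insert Infinity {Affine x y | x y. flex E x y}"
proof (rule Set.set_eqI)
  fix P :: "'a point"
  obtain a1 a2 a3 a4 a6 where E: "E = Weierstrass a1 a2 a3 a4 a6" by (cases E)
  have "P \<in> carrier (torsion_group 3 E) \<longleftrightarrow>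
      on_curve E P \<and> point_add E (point_add E P P) P = Infinity"
    by (simp add: torsion_group_def point_group_def nat_pow_def numeral_3_eq_3)
  also have "\<dots> \<longleftrightarrow> P \<in> insert Infinity {Affine x y | x y. flex E x y}"
  proof (cases P)
    case Infinity
    then show ?thesis by simp
  next
    case (Affine x y)
    define D where "D = 2 * y + a1 * x + a3"
    define l where "l = (3 * x^2 + 2 * a2 * x + a4 - a1 * y) / D"
    have D: "y = - y - a1 * x - a3 \<longleftrightarrow> D = 0"
      by (rule diff_eq_diff_eq) (simp add: D_def)
    show ?thesis
    proof (cases "D = 0")
      case True
      with D have "y = - y - a1 * x - a3" by blast
      then have "point_add E P P = Infinity"
        by (simp add: E Affine)
      then show ?thesis using True
        by (simp add: Affine E flex_Weierstrass D_def)
    next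
      case False
      define x2 where "x2 = l^2 + a1 * l - a2 - x - x"
      have "point_add E P P = Affine x2 (- (l * (x2 - x) + y) - a1 * x2 - a3)"
        using False D by (simp add: E Affine Let_def x2_def l_def D_def)
      \<comment> \<open>For \<open>x2 = x\<close> the slope term vanishes and the double is exactly
        the negative of \<open>P\<close>.\<close>
      then have "point_add E (point_add E P P) P = Infinity \<longleftrightarrow> x2 = x"
        by (auto simp add: E Affine Let_def)
      moreover have "k * D = 3 * x^2 + 2 * a2 * x + a4 - a1 * y \<longleftrightarrow> k = l" for k
        using False by (auto simp: l_def field_simps)
      ultimately show ?thesis using False
        by (simp add: Affine E flex_Weierstrass x2_def flip: D_def)
    qed
  qed
  finally show "P \<in> carrier (torsion_group 3 E) \<longleftrightarrow>
      P \<in> insert Infinity {Affine x y | x y. flex E x y}" .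
qed

text \<open>Composing with the change that puts \<open>E'\<close> in Deuring form gives such a
  change for \<open>E\<close>, once its scaling is absorbed.\<close>

lemma flex_coord_change:
  assumes "u \<noteq> 0" "coord_change u r s t E E'" "flex E' x y"
  shows "flex E (u^2 * x + r) (u^3 * y + s * u^2 * x + t)"
proof -
  obtain l a b where "b \<noteq> 0" "coord_change 1 x l y E' (deuring a b)"
    using assms(3) by (auto simp: flex_def)
  with coord_change_trans[OF assms(2) this(2)] assms(1) show ?thesis
    unfolding flex_def coord_change_deuring_scale[of "u * 1"]
    by (metis mult_eq_0_iff mult.right_neutral power_eq_0_iff)
qed

lemma finite_points: "finite (A :: 'a::finite point set)"
proof (rule finite_subset)
  show "A \<subseteq> insert Infinity (range (\<lambda>(x, y). Affine x y))"
  proof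
    fix P assume "P \<in> A"
    show "P \<in> insert Infinity (range (\<lambda>(x, y). Affine x y))"
      by (cases P) (auto simp: image_iff)
  qed
qed simp

text \<open>The change of variables acts injectively on points and preserves flexes; symmetry of
  isomorphism then gives equality.\<close>

lemma order_torsion_group_3_le:
  fixes E E' :: "'a::{field,finite} weierstrass"
  assumes "isomorphic_curves E E'"
  shows "order (torsion_group 3 E') \<le> order (torsion_group 3 E)"
proof -
  obtain u r s t where u: "u \<noteq> 0" and c: "coord_change u r s t E E'"
    using assms by (auto simp: isomorphic_curves_iff_coord_change)
  define f where "f P = (case P of Infinity \<Rightarrow> Infinity
    | Affine x y \<Rightarrow> Affine (u^2 * x + r) (u^3 * y + s * u^2 * x + t))" for P
  have "inj f"
    using u by (auto simp: inj_def f_def split: point.splits)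
  moreover have "f ` carrier (torsion_group 3 E') \<subseteq> carrier (torsion_group 3 E)"
    using flex_coord_change[OF u c] by (auto simp: carrier_torsion_group_3 f_def)
  ultimately show ?thesis
    unfolding order_def by (rule card_inj_on_le[OF inj_on_subset[OF _ subset_UNIV] _ finite_points])
qed

lemma order_torsion_group_3_eq:
  fixes E E' :: "'a::{field,finite} weierstrass"
  assumes "isomorphic_curves E E'"
  shows "order (torsion_group 3 E') = order (torsion_group 3 E)"
  by (rule antisym[OF order_torsion_group_3_le[OF assms]
        order_torsion_group_3_le[OF isomorphic_curves_sym[OF assms]]])

section \<open>Deuring normal forms\<close>

lemma discriminant_deuring: "discriminant (deuring a b) = b^3 * (a^3 - 27 * b)"
  by (simp add: Let_def power2_eq_square power3_eq_cube algebra_simps)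

lemma flex_deuring_0: "b \<noteq> 0 \<Longrightarrow> flex (deuring a b) 0 y \<longleftrightarrow> y = 0 \<or> y = - b"
proof -
  assume b: "b \<noteq> 0"
  have "y^2 + b * y = y * (y + b)" by (simp add: power2_eq_square algebra_simps)
  then have "y^2 + b * y = 0 \<longleftrightarrow> y = 0 \<or> y = - b" by (simp add: eq_neg_iff_add_eq_0)
  then show ?thesis using b
    \<comment> \<open>The tangent slopes are \<open>0\<close> at the origin and \<open>- a\<close>
      at the point \<open>(0, - b)\<close>.\<close>
    by (auto simp: flex_Weierstrass power2_eq_square intro: exI[of _ 0] exI[of _ "- a"])
qed

text \<open>With \<open>D = 2 * y + a * x + b\<close> and tangent slope
  \<open>l = (3 * x^2 - a * y) / D\<close>, the left side is
  \<open>D^2 * (l^2 + a * l - 3 * x)\<close>: the flex condition with denominators cleared.\<close>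

lemma deuring_tangent:
  fixes a b x y :: "'a::field"
  assumes "y^2 + a * x * y + b * y = x^3"
  shows "(3 * x^2 - a * y)^2 + a * (2 * y + a * x + b) * (3 * x^2 - a * y)
      - 3 * x * (2 * y + a * x + b)^2 = - (x * (3 * x^3 + a^2 * x^2 + 3 * a * b * x + 3 * b^2))"
proof -
  have "(3 * x^2 - a * y)^2 + a * (2 * y + a * x + b) * (3 * x^2 - a * y)
      - 3 * x * (2 * y + a * x + b)^2
    = 9 * x^4 + 3 * a * x^2 * (a * x + b) - a^2 * (y^2 + a * x * y + b * y)
      - 3 * x * (4 * (y^2 + a * x * y + b * y) + (a * x + b)^2)"
    by (simp add: power_numeral_reduce algebra_simps)
  also have "\<dots> = - (x * (3 * x^3 + a^2 * x^2 + 3 * a * b * x + 3 * b^2))"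
    unfolding assms by (simp add: power_numeral_reduce algebra_simps)
  finally show ?thesis .
qed

text \<open>This completes the cube in the variable \<open>1 / x\<close>, again with denominators
  cleared.\<close>

lemma deuring_division_polynomial:
  fixes a b x :: "'a::field"
  shows "9 * b * (3 * x^3 + a^2 * x^2 + 3 * a * b * x + 3 * b^2)
    = (a * x + 3 * b)^3 - (a^3 - 27 * b) * x^3"
proof -
  have "(a * x + 3 * b)^3 = a^3 * x^3 + 9 * (a^2 * b * x^2) + 27 * (a * b^2 * x) + 27 * b^3"
    by (simp add: power2_eq_square power3_eq_cube algebra_simps)
  then show ?thesis
    by (simp add: ring_distribs mult.assoc) (simp add: power2_eq_square power3_eq_cube)
qed

text \<open>The \<open>x\<close>-coordinate \<open>x \<noteq> 0\<close> is a root of the 3-division polynomial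
  \<open>3 x^3 + a^2 x^2 + 3 a b x + 3 b^2\<close>, which becomes a pure cubic in \<open>a + 3 b / x\<close>.\<close>

lemma flex_deuring_imp_cube:
  assumes "flex (deuring a b) x y" "x \<noteq> 0"
  shows "((a * x + 3 * b) / x)^3 = a^3 - 27 * b"
proof -
  obtain l where eqs: "y^2 + a * x * y + b * y = x^3"
    "l * (2 * y + a * x + b) = 3 * x^2 - a * y" "l^2 + a * l = 3 * x"
    using assms(1) by (auto simp: flex_Weierstrass algebra_simps)
  \<comment> \<open>Multiplying by the square of the slope denominator leaves only the product
    \<open>l * d\<close>, which the tangent equation makes explicit.\<close>
  have "l^2 * d^2 + a * l * d^2 = (l * d)^2 + a * d * (l * d)" for d
    by (simp add: power_numeral_reduce algebra_simps)
  from this[of "2 * y + a * x + b"]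
  have "(3 * x^2 - a * y)^2 + a * (2 * y + a * x + b) * (3 * x^2 - a * y)
      - 3 * x * (2 * y + a * x + b)^2 = 0"
    unfolding eqs(2) eqs(3)[symmetric] by (simp add: ring_distribs)
  with assms(2) have "3 * x^3 + a^2 * x^2 + 3 * a * b * x + 3 * b^2 = 0"
    unfolding deuring_tangent[OF eqs(1)] by simp
  with deuring_division_polynomial[of b x a] have "(a * x + 3 * b)^3 = (a^3 - 27 * b) * x^3"
    by simp
  with assms(2) show ?thesis
    by (simp add: power_divide)
qed

text \<open>The abscissa is found by solving \<open>c = a + 3 * b / x\<close>. The condition
  \<open>c \<noteq> 0\<close>, which is nonsingularity, keeps the tangent from being vertical, since
  \<open>3 * D\<close> is a nonzero multiple of \<open>c * x\<close>.\<close>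

lemma flex_deuring_of_cube:
  fixes a b c \<omega> :: "'a::field"
  assumes "\<omega>^2 + \<omega> + 1 = 0" "(3::'a) \<noteq> 0" "b \<noteq> 0" "c \<noteq> 0" "c^3 = a^3 - 27 * b"
  shows "\<exists>x y. x \<noteq> 0 \<and> flex (deuring a b) x y"
proof -
  have "(27::'a) = 3^3" by simp
  with assms(2) have "(27::'a) \<noteq> 0" by (metis power_eq_0_iff)
  with assms have "c \<noteq> a" by auto
  define x where "x = 3 * b / (c - a)"
  have x: "x \<noteq> 0" "c * x = a * x + 3 * b"
    using \<open>c \<noteq> a\<close> assms(2,3) by (auto simp: x_def field_simps)
  \<comment> \<open>\<open>psi\<close> below makes the discriminant \<open>4 x\<^sup>3 + (a x + b)\<^sup>2\<close> of the quadratic equation for \<open>y\<close>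
     equal to \<open>- (a x + 3 b)\<^sup>2 / 3\<close>; \<open>y\<close> is written without dividing by 2.\<close>
  define y where "y = (\<omega> * (a * x + 3 * b) - a * x) / 3"
  have y: "3 * y = \<omega> * (a * x + 3 * b) - a * x"
    using assms(2) by (simp add: y_def)
  define D where "D = 2 * y + a * x + b"
  have D3: "3 * D = (2 * \<omega> + 1) * c * x"
  proof -
    have "3 * D = 2 * (3 * y) + 3 * (a * x + b)"
      unfolding D_def by (simp add: power_numeral_reduce algebra_simps)
    also have "\<dots> = (2 * \<omega> + 1) * (a * x + 3 * b)"
      unfolding y by (simp add: power_numeral_reduce algebra_simps)
    finally show ?thesis by (simp add: mult.assoc x(2))
  qed
  have "(2 * \<omega> + 1)^2 = 4 * (\<omega>^2 + \<omega> + 1) - 3"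
    by (simp add: power_numeral_reduce algebra_simps)
  then have "(2 * \<omega> + 1)^2 = -3"
    using assms(1) by simp
  with assms(2) have "2 * \<omega> + 1 \<noteq> 0"
    by auto
  with D3 x(1) assms(4) have D: "D \<noteq> 0" by auto
  have "9 * b * (3 * x^3 + a^2 * x^2 + 3 * a * b * x + 3 * b^2) = 0"
    unfolding deuring_division_polynomial x(2)[symmetric] assms(5)[symmetric]
    by (simp add: power_mult_distrib)
  moreover have "(9::'a) = 3 * 3" by simp
  then have 9: "(9::'a) \<noteq> 0"
    using assms(2) by (metis mult_eq_0_iff)
  ultimately have psi: "3 * x^3 + a^2 * x^2 + 3 * a * b * x + 3 * b^2 = 0"
    using assms(3) by simp
  have "9 * (y^2 + a * x * y + b * y - x^3) = 0"
  proof -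
    have "9 * (y^2 + a * x * y + b * y - x^3) = (3 * y)^2 + 3 * (a * x + b) * (3 * y) - 9 * x^3"
      by (simp add: power_numeral_reduce algebra_simps)
    also have "\<dots> = (\<omega>^2 + \<omega> + 1) * (a * x + 3 * b)^2
        - 3 * (3 * x^3 + a^2 * x^2 + 3 * a * b * x + 3 * b^2)"
      unfolding y by (simp add: power_numeral_reduce algebra_simps)
    finally show ?thesis
      unfolding psi assms(1) by simp
  qed
  with 9 have on: "y^2 + a * x * y + b * y = x^3"
    by (metis eq_iff_diff_eq_0 mult_eq_0_iff)
  define l where "l = (3 * x^2 - a * y) / D"
  have l: "l * D = 3 * x^2 - a * y"
    using D by (simp add: l_def)
  have "D^2 * (l^2 + a * l - 3 * x) = (l * D)^2 + a * D * (l * D) - 3 * x * D^2"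
    by (simp add: power_numeral_reduce algebra_simps)
  also have "\<dots> = 0"
    unfolding l unfolding D_def deuring_tangent[OF on] psi by simp
  finally have "l^2 + a * l = 3 * x" using D by simp
  then have "flex (deuring a b) x y"
    using D l on by (auto simp: flex_Weierstrass D_def intro!: exI[of _ l])
  with x(1) show ?thesis by blast
qed

text \<open>A flex off the line \<open>x = 0\<close> would exhibit a cube root, and
  \<open>b = 0\<close> would leave the cube \<open>a^3\<close>.\<close>

lemma torsion_group_3_deuring:
  fixes a b :: "'a::field"
  assumes "\<not> is_nth_power 3 (a^3 - 27 * b)"
  shows "b \<noteq> 0" and "flex (deuring a b) x y \<longleftrightarrow> x = 0 \<and> (y = 0 \<or> y = - b)"
    and "carrier (torsion_group 3 (deuring a b)) = {Infinity, Affine 0 0, Affine 0 (- b)}"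
proof -
  show b: "b \<noteq> 0"
    using assms by auto
  show flex: "flex (deuring a b) x y \<longleftrightarrow> x = 0 \<and> (y = 0 \<or> y = - b)" for x y
    using flex_deuring_0[OF b] flex_deuring_imp_cube assms by (metis is_nth_powerI)
  show "carrier (torsion_group 3 (deuring a b)) = {Infinity, Affine 0 0, Affine 0 (- b)}"
    unfolding carrier_torsion_group_3 flex by auto
qed

text \<open>The torsion consists of three explicit points, so the group axioms are read off their
  addition table.\<close>

lemma deuring_in_cyclic_3_torsion_curves:
  fixes a b :: "'a::field"
  assumes "\<not> is_nth_power 3 (a^3 - 27 * b)"
  shows "deuring a b \<in> cyclic_3_torsion_curves"
proof -
  let ?T = "torsion_group 3 (deuring a b)"
  note b = torsion_group_3_deuring(1)[OF assms]
    and carrier = torsion_group_3_deuring(3)[OF assms]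
  have ops: "monoid.mult ?T = point_add (deuring a b)" "one ?T = Infinity"
    by (simp_all add: torsion_group_def point_group_def)
  \<comment> \<open>Since \<open>0\<close> counts as a cube, the hypothesis includes
    nonsingularity.\<close>
  have "a^3 - 27 * b \<noteq> 0"
    using assms by auto
  then have ell: "elliptic_curve (deuring a b)"
    using b unfolding elliptic_curve_def discriminant_deuring by simp
  have order: "order ?T = 3"
    using b by (simp add: order_def carrier)
  have add: "point_add (deuring a b) (Affine 0 0) (Affine 0 0) = Affine 0 (- b)"
    "point_add (deuring a b) (Affine 0 0) (Affine 0 (- b)) = Infinity"
    "point_add (deuring a b) (Affine 0 (- b)) (Affine 0 0) = Infinity"
    "point_add (deuring a b) (Affine 0 (- b)) (Affine 0 (- b)) = Affine 0 0"
    using b by (simp_all add: Let_def power2_eq_square)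
  have add_Inf: "point_add (deuring a b) P Infinity = P" for P
    by (cases P) simp_all
  let ?O = "Affine 0 0" and ?N = "Affine 0 (- b)"
  have assoc: "\<forall>P\<in>{Infinity, ?O, ?N}. \<forall>Q\<in>{Infinity, ?O, ?N}. \<forall>R\<in>{Infinity, ?O, ?N}.
      point_add (deuring a b) (point_add (deuring a b) P Q) R
      = point_add (deuring a b) P (point_add (deuring a b) Q R)"
    by (simp add: add add_Inf del: point_add.simps(3))
  have closed: "\<forall>P\<in>{Infinity, ?O, ?N}. \<forall>Q\<in>{Infinity, ?O, ?N}.
      point_add (deuring a b) P Q \<in> {Infinity, ?O, ?N}"
    by (simp add: add add_Inf del: point_add.simps(3))
  have inverse: "\<forall>P\<in>{Infinity, ?O, ?N}. \<exists>Q\<in>{Infinity, ?O, ?N}.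
      point_add (deuring a b) Q P = Infinity"
    by (simp add: add add_Inf del: point_add.simps(3))
  interpret group ?T
  proof (rule groupI, unfold carrier ops)
    show "point_add (deuring a b) P Q \<in> {Infinity, ?O, ?N}"
      if "P \<in> {Infinity, ?O, ?N}" "Q \<in> {Infinity, ?O, ?N}" for P Q
      using closed[THEN bspec, THEN bspec, OF that] .
    show "point_add (deuring a b) (point_add (deuring a b) P Q) R
      = point_add (deuring a b) P (point_add (deuring a b) Q R)"
      if "P \<in> {Infinity, ?O, ?N}" "Q \<in> {Infinity, ?O, ?N}" "R \<in> {Infinity, ?O, ?N}" for P Q R
      using assoc[THEN bspec, THEN bspec, THEN bspec, OF that] .
    show "\<exists>Q\<in>{Infinity, ?O, ?N}. point_add (deuring a b) Q P = Infinity"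
      if "P \<in> {Infinity, ?O, ?N}" for P
      using inverse that by (rule bspec)
  qed simp_all
  \<comment> \<open>The third point is the double of the origin, so the origin generates.\<close>
  have "?N \<in> generate ?T {?O}"
    using generate.eng[OF generate.incl generate.incl, of ?O "{?O}" ?O ?T]
    unfolding ops add by simp
  then have "carrier ?T \<subseteq> generate ?T {?O}"
    using generate.one[of ?T "{?O}"] generate.incl[of ?O "{?O}" ?T] unfolding carrier ops by simp
  moreover have "generate ?T {Affine 0 0} \<subseteq> carrier ?T"
    by (intro generate_incl) (simp add: carrier)
  ultimately have "subgroup_generated ?T {Affine 0 0} = ?T"
    by (auto simp: subgroup_generated_def carrier intro!: monoid.equality)
  then have "cyclic_group ?T"
    unfolding cyclic_group_def by (intro bexI[of _ "Affine 0 0"]) (auto simp: carrier)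
  with ell order show ?thesis
    by (simp add: cyclic_3_torsion_curves_def)
qed

lemma isomorphic_deuring_scale: "u \<noteq> 0 \<Longrightarrow> isomorphic_curves (deuring (u * a) (u^3 * b)) (deuring a b)"
  unfolding isomorphic_curves_iff_coord_change
  by (rule exI[of _ u], rule exI[of _ 0], rule exI[of _ 0], rule exI[of _ 0]) simp

text \<open>The parameters \<open>(r, t)\<close> of the isomorphism form a flex of the source, hence
  are the origin or its negative.\<close>

lemma isomorphic_deuringD:
  assumes "\<not> is_nth_power 3 (a^3 - 27 * b)" "b' \<noteq> 0"
    and "isomorphic_curves (deuring a b) (deuring a' b')"
  shows "\<exists>u. u \<noteq> 0 \<and> a = u * a' \<and> b = u^3 * b'"
proof -
  obtain u r s t where u: "u \<noteq> 0" and c: "coord_change u r s t (deuring a b) (deuring a' b')"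
    using assms(3) by (auto simp: isomorphic_curves_iff_coord_change)
  have "flex (deuring a b) r t"
    using u assms(2) c unfolding flex_def coord_change_deuring_scale[of u]
    by (metis mult_eq_0_iff power_eq_0_iff)
  then have "r = 0" and t: "t = 0 \<or> t = - b"
    using torsion_group_3_deuring(2)[OF assms(1)] by auto
  note b = torsion_group_3_deuring(1)[OF assms(1)]
  from t show ?thesis
  proof
    assume "t = 0"
    with c \<open>r = 0\<close> b u show ?thesis
      by (intro exI[of _ u]) auto
  next
    \<comment> \<open>Here the isomorphism is a scaling combined with negation of points, and the
      sign is absorbed into \<open>- u\<close>.\<close>
    assume t: "t = - b"
    with c \<open>r = 0\<close> have "b * (s + a) = 0" "u * a' = a + 2 * s" "u^3 * b' = - b"
      by (auto simp: algebra_simps)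
    with b have "s = - a" by (simp add: eq_neg_iff_add_eq_0)
    with \<open>u * a' = a + 2 * s\<close> have "u * a' = - a" by simp
    with \<open>u^3 * b' = - b\<close> u show ?thesis
      by (intro exI[of _ "- u"]) simp
  qed
qed

text \<open>An affine torsion point yields a Deuring form. If its \<open>a^3 - 27 * b\<close> were a
  cube, a further flex would give a fourth torsion point, although isomorphism preserves the order
  three.\<close>

lemma cyclic_3_torsion_curve_deuring:
  fixes E :: "'a::{field,finite} weierstrass" and \<omega> :: 'a
  assumes "\<omega>^2 + \<omega> + 1 = 0" "(3::'a) \<noteq> 0" "E \<in> cyclic_3_torsion_curves"
  obtains a b where "\<not> is_nth_power 3 (a^3 - 27 * b)" "isomorphic_curves E (deuring a b)"
proof -
  have ord: "order (torsion_group 3 E) = 3" and ell: "discriminant E \<noteq> 0"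
    using assms(3) by (auto simp: cyclic_3_torsion_curves_def elliptic_curve_def)
  have "\<not> carrier (torsion_group 3 E) \<subseteq> {Infinity}"
    using ord card_mono[of "{Infinity}" "carrier (torsion_group 3 E)"] by (auto simp: order_def)
  then obtain x y where "flex E x y"
    by (auto simp: carrier_torsion_group_3)
  then obtain l a b where b: "b \<noteq> 0" and c: "coord_change 1 x l y E (deuring a b)"
    by (auto simp: flex_def)
  have iso: "isomorphic_curves E (deuring a b)"
    unfolding isomorphic_curves_iff_coord_change using c one_neq_zero by blast
  have "\<not> is_nth_power 3 (a^3 - 27 * b)"
  proof
    assume "is_nth_power 3 (a^3 - 27 * b)"
    then obtain k where k: "a^3 - 27 * b = k^3"
      by (auto elim: is_nth_powerE)
    have "a^3 - 27 * b \<noteq> 0"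
      using ell discriminant_coord_change_1[OF c] unfolding discriminant_deuring by auto
    with k have "k \<noteq> 0" by auto
    then obtain x' y' where xy: "x' \<noteq> 0" "flex (deuring a b) x' y'"
      using flex_deuring_of_cube[OF assms(1,2) b _ k[symmetric]] by blast
    have "card {Infinity, Affine 0 0, Affine 0 (- b), Affine x' y'} \<le>
        order (torsion_group 3 (deuring a b))"
      unfolding order_def carrier_torsion_group_3
      using xy b by (intro card_mono finite_points) (auto simp: flex_deuring_0)
    also have "\<dots> = 3"
      using order_torsion_group_3_eq[OF iso] ord by simp
    finally show False
      using xy(1) b by simp
  qed
  with iso show ?thesis using that by blast
qed

section \<open>Cubes in a finite field\<close>

lemma finite_field_power_card_minus_1:
  fixes x :: "'a::{field,finite}"
  assumes "x \<noteq> 0"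
  shows "x ^ (card (UNIV :: 'a set) - 1) = 1"
proof -
  have "(\<Prod>y\<in>UNIV-{0}. x * y) = (\<Prod>y\<in>UNIV-{0}. y)"
    by (rule prod.reindex_bij_witness[of _ "\<lambda>y. y / x" "\<lambda>y. x * y"]) (use assms in auto)
  then have "x ^ (card (UNIV :: 'a set) - 1) * \<Prod>(UNIV-{0}) = 1 * \<Prod>(UNIV-{0::'a})"
    by (simp add: prod.distrib)
  then show ?thesis
    unfolding mult_cancel_right by simp
qed

lemma card_nth_roots_le:
  fixes c :: "'a::idom"
  assumes "n > 0"
  shows "card {x. x ^ n = c} \<le> n"
proof -
  let ?p = "Polynomial.monom 1 n - [:c:]"
  have "Polynomial.degree ?p \<le> n"
    by (intro degree_diff_le degree_monom_le) simp
  moreover have "Polynomial.coeff ?p n \<noteq> 0"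
    using assms by (cases n) (simp_all add: coeff_pCons)
  then have "?p \<noteq> 0"
    by (metis coeff_0)
  moreover have "{x. x ^ n = c} = {x. poly ?p x = 0}"
    by (simp add: Polynomial.poly_monom)
  ultimately show ?thesis
    using card_poly_roots_bound[of ?p] by (metis order.trans)
qed

lemma cube_eq_1_iff:
  fixes x \<omega> :: "'a::field"
  assumes "\<omega>^2 + \<omega> + 1 = 0"
  shows "x^3 = 1 \<longleftrightarrow> x = 1 \<or> x = \<omega> \<or> x = \<omega>^2"
proof -
  have w: "\<omega>^2 = - 1 - \<omega>" using assms by (simp add: algebra_simps eq_neg_iff_add_eq_0)
  have "x^3 - 1 = (x - 1) * ((x - \<omega>) * (x - \<omega>^2))"
  proof -
    have "(x - \<omega>) * (x - \<omega>^2) = x^2 - x * (\<omega> + \<omega>^2) + \<omega> * \<omega>^2"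
      by (simp add: algebra_simps power2_eq_square)
    also have "\<omega> * \<omega>^2 = - \<omega> - \<omega>^2"
      unfolding w by (simp add: algebra_simps w[unfolded power2_eq_square])
    also have "\<dots> = 1"
      unfolding w by simp
    also have "\<omega> + \<omega>^2 = - 1"
      unfolding w by simp
    finally show ?thesis
      by (simp add: algebra_simps power2_eq_square power3_eq_cube)
  qed
  moreover have "x^3 = 1 \<longleftrightarrow> x^3 - 1 = 0"
    by simp
  ultimately show ?thesis
    by simp
qed

lemma cube_root_of_unity:
  fixes \<omega> :: "'a::field"
  assumes "\<omega> \<noteq> 1" "\<omega>^3 = 1"
  shows "\<omega>^2 + \<omega> + 1 = 0"
proof -
  have "(\<omega> - 1) * (\<omega>^2 + \<omega> + 1) = \<omega>^3 - 1"
    by (simp add: algebra_simps power2_eq_square power3_eq_cube)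
  with assms show ?thesis by simp
qed

lemma is_cube_mult_cube:
  fixes u x :: "'a::field"
  assumes "u \<noteq> 0"
  shows "is_nth_power 3 (u^3 * x) \<longleftrightarrow> is_nth_power 3 x"
proof
  assume "is_nth_power 3 (u^3 * x)"
  then obtain y where "u^3 * x = y^3" by (auto elim: is_nth_powerE)
  then have "x = (y / u)^3" using assms by (simp add: power_divide field_simps)
  then show "is_nth_power 3 x" by (rule is_nth_powerI)
next
  assume "is_nth_power 3 x"
  then show "is_nth_power 3 (u^3 * x)"
    by (auto simp: is_nth_power_def simp flip: power_mult_distrib)
qed

text \<open>With the cardinality written as \<open>3 * k + 1\<close>, the map
  \<open>x \<mapsto> x ^ k\<close> is the cubic residue character on nonzero elements.\<close>

locale finite_field_1_mod_3 =
  fixes k :: nat and field_type :: "'a::{field,finite} itself"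
  assumes card_UNIV: "card (UNIV :: 'a set) = 3 * k + 1"
begin

lemma k_pos: "k > 0"
proof (rule ccontr)
  assume "\<not> k > 0"
  then have "card (UNIV :: 'a set) = 1" using card_UNIV by simp
  moreover have "card {0, 1::'a} \<le> card (UNIV :: 'a set)" by (rule card_mono) auto
  ultimately show False by simp
qed

lemma three_neq_0: "(3::'a) \<noteq> 0"
proof
  assume "(3::'a) = 0"
  then have "of_nat 3 = (0::'a)" by simp
  then have "CHAR('a) dvd 3" by (simp only: of_nat_eq_0_iff_char_dvd)
  moreover have "CHAR('a) \<noteq> 1" by simp
  moreover have "prime (3::nat)" by simp
  ultimately have "CHAR('a) = 3" by (metis prime_nat_iff)
  then have "3 dvd 3 * k + 1" using CHAR_dvd_CARD[where 'a='a] card_UNIV by simp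
  then show False by presburger
qed

lemma power_k_cubed: "x \<noteq> 0 \<Longrightarrow> (x ^ k) ^ 3 = (1::'a)"
  using finite_field_power_card_minus_1[of x] by (simp add: card_UNIV mult.commute flip: power_mult)

lemma card_nonzero: "card (UNIV - {0::'a}) = 3 * k"
  by (simp add: card_UNIV)

text \<open>Nonzero cubes lie among the at most \<open>k\<close> roots of \<open>x ^ k = 1\<close>,
  while fibres of cubing have at most three elements, so there are at least \<open>k\<close>
  cubes.\<close>

lemma nonzero_cubes_eq: "(\<lambda>x. x ^ 3) ` (UNIV - {0::'a}) = {x. x ^ k = 1}" (is "?C = ?R")
  and card_nonzero_cubes: "card {x::'a. x ^ k = 1} = k"
proof -
  have sub: "?C \<subseteq> ?R"
    using power_k_cubed by (auto simp: mult.commute simp flip: power_mult)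
  have le: "card ?R \<le> k"
    using k_pos by (rule card_nth_roots_le)
  have "3 * k = card (\<Union>c\<in>?C. {x. x ^ 3 = c} - {0})"
    unfolding card_nonzero[symmetric] by (rule arg_cong[of _ _ card]) auto
  also have "\<dots> \<le> (\<Sum>c\<in>?C. card ({x. x ^ 3 = c} - {0}))"
    by (rule card_UN_le) simp
  also have "\<dots> \<le> (\<Sum>c\<in>?C. 3)"
    by (intro sum_mono order.trans[OF card_mono card_nth_roots_le]) auto
  finally have ge: "k \<le> card ?C" by simp
  show "?C = ?R"
    using sub le ge by (intro card_seteq) auto
  with le ge show "card ?R = k" by simp
qed

lemma is_cube_iff: "x \<noteq> 0 \<Longrightarrow> is_nth_power 3 (x::'a) \<longleftrightarrow> x ^ k = 1"
proof -
  assume "x \<noteq> 0"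
  then have "is_nth_power 3 x \<longleftrightarrow> x \<in> (\<lambda>x. x ^ 3) ` (UNIV - {0})"
    by (auto simp: is_nth_power_def)
  then show ?thesis unfolding nonzero_cubes_eq by simp
qed

lemma card_noncubes: "card {x::'a. \<not> is_nth_power 3 x} = 2 * k"
proof -
  have "{x::'a. \<not> is_nth_power 3 x} = (UNIV - {0}) - {x. x ^ k = 1}"
  proof (rule Set.set_eqI)
    show "x \<in> {x. \<not> is_nth_power 3 x} \<longleftrightarrow> x \<in> (UNIV - {0}) - {x. x ^ k = 1}" for x :: 'a
      using is_cube_iff[of x] by (cases "x = 0") simp_all
  qed
  moreover have "{x::'a. x ^ k = 1} \<subseteq> UNIV - {0}"
    using k_pos by (auto simp: power_0_left)
  ultimately show ?thesis
    by (simp add: card_Diff_subset card_nonzero card_nonzero_cubes)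
qed

lemma ex_noncube: "\<exists>b::'a. \<not> is_nth_power 3 b"
proof (rule ccontr)
  assume "\<nexists>b::'a. \<not> is_nth_power 3 b"
  then have "{x::'a. \<not> is_nth_power 3 x} = {}" by blast
  with card_noncubes k_pos show False by simp
qed

text \<open>The character value of a noncube is a primitive cube root of unity; it later serves as
  the \<open>\<omega>\<close> of the Deuring lemmas.\<close>

lemma noncube_power_k:
  fixes b0 :: 'a
  assumes "\<not> is_nth_power 3 b0"
  shows "b0 \<noteq> 0" and "(b0 ^ k)^2 + b0 ^ k + 1 = 0"
proof -
  show b0: "b0 \<noteq> 0" using assms by auto
  have "b0 ^ k \<noteq> 1"
    using assms is_cube_iff b0 by blast
  then show "(b0 ^ k)^2 + b0 ^ k + 1 = 0"
    using power_k_cubed[OF b0] by (rule cube_root_of_unity)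
qed

lemma noncube_powers:
  fixes b0 :: 'a
  assumes "\<not> is_nth_power 3 b0"
  shows "\<not> is_nth_power 3 (b0^2)"
proof
  have "(b0^2) ^ k = (b0 ^ k)^2" by (simp add: mult.commute flip: power_mult)
  moreover assume "is_nth_power 3 (b0^2)"
  ultimately have "(b0 ^ k)^2 = 1"
    using noncube_power_k(1)[OF assms] is_cube_iff[of "b0^2"] by simp
  with power_k_cubed[OF noncube_power_k(1)[OF assms]] have "b0 ^ k = 1"
    by (simp add: power3_eq_cube power2_eq_square)
  with assms is_cube_iff noncube_power_k(1)[OF assms] show False by blast
qed

text \<open>The character value of \<open>b\<close> is a power of that of \<open>b0\<close>;
  dividing by the matching \<open>b0 ^ i\<close> leaves an element of trivial character, hence a
  cube.\<close>

lemma cube_class_exists: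
  fixes b b0 :: 'a
  assumes "\<not> is_nth_power 3 b0" "b \<noteq> 0"
  obtains i :: nat and u where "i \<in> {0, 1, 2}" "u \<noteq> 0" "b = u^3 * b0 ^ i"
proof -
  note b0 = noncube_power_k[OF assms(1)]
  obtain i :: nat where i: "i \<in> {0, 1, 2}" "b ^ k = (b0 ^ k) ^ i"
    using power_k_cubed[OF assms(2)] unfolding cube_eq_1_iff[OF b0(2)]
    by (metis insertCI power_0 power_one_right)
  have "(b / b0 ^ i) ^ k = 1"
    using b0(1) i(2) by (simp add: power_divide mult.commute flip: power_mult)
  moreover have nz: "b / b0 ^ i \<noteq> 0"
    using assms(2) b0(1) by simp
  ultimately obtain u where u: "b / b0 ^ i = u^3"
    using is_cube_iff[OF nz] by (auto elim: is_nth_powerE)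
  then have "b = u^3 * b0 ^ i" "u \<noteq> 0"
    using b0(1) nz by (auto simp: field_simps)
  with i(1) show ?thesis using that by blast
qed

text \<open>Distinct exponents would make \<open>b0\<close> or \<open>b0^2\<close> a cube.\<close>

lemma cube_class_unique:
  fixes b0 u :: 'a and i j :: nat
  assumes "\<not> is_nth_power 3 b0" "u \<noteq> 0" "b0 ^ i = u^3 * b0 ^ j"
    and "i \<in> {0, 1, 2}" "j \<in> {0, 1, 2}"
  shows "i = j"
proof (rule ccontr)
  assume "i \<noteq> j"
  note b0 = noncube_power_k(1)[OF assms(1)]
  have inv: "u^3 * w = v \<Longrightarrow> w = (1 / u)^3 * v" for v w
    using assms(2) by (auto simp: power_divide)
  have "is_nth_power 3 b0 \<or> is_nth_power 3 (b0^2)"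
    using assms(3-5) \<open>i \<noteq> j\<close> b0 inv[of b0 1] inv[of "b0^2" 1] inv[of "b0^2" b0] inv[of b0 1]
    by (auto simp: power2_eq_square is_nth_power_def intro: exI[of _ u] exI[of _ "1/u"])
  with assms(1) noncube_powers[OF assms(1)] show False by blast
qed

end

section \<open>Representatives of a quotient and minima of finite sets\<close>

lemma family_of_representatives_quotient:
  assumes "equiv S r" "R \<subseteq> S"
    and ex: "\<And>x. x \<in> S \<Longrightarrow> \<exists>y\<in>R. (x, y) \<in> r"
    and unique: "\<And>x y. x \<in> R \<Longrightarrow> y \<in> R \<Longrightarrow> (x, y) \<in> r \<Longrightarrow> x = y"
  shows "family_of_representatives R (S // r)" and "card (S // r) = card R"
proof -
  have "\<exists>!y. y \<in> R \<and> y \<in> r `` {x}" if "x \<in> S" for x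
    using ex[OF that] unique assms(1) by (metis Image_singleton_iff equivE symE transE)
  then show "family_of_representatives R (S // r)"
    unfolding family_of_representatives_def Union_quotient[OF assms(1)]
    using assms(2) by (blast elim!: quotientE)
  have "bij_betw (\<lambda>x. r `` {x}) R (S // r)"
    unfolding bij_betw_def
  proof
    show "inj_on (\<lambda>x. r `` {x}) R"
      using unique assms(1,2) by (auto intro!: inj_onI dest: eq_equiv_class)
    show "(\<lambda>x. r `` {x}) ` R = S // r"
      using ex assms(1,2) by (fastforce simp: quotient_def dest: equiv_class_eq)
  qed
  then show "card (S // r) = card R"
    by (metis bij_betw_same_card)
qed

text \<open>The definite description is meaningful: a minimum exists by induction on the finite set
  and is unique by antisymmetry.\<close>

lemma min_wrt_in:
  assumes "linear_order r" "finite A" "A \<noteq> {}"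
  shows "min_wrt r A \<in> A"
proof -
  have "\<exists>m\<in>A. \<forall>x\<in>A. (m, x) \<in> r"
    using assms(2,3)
  proof (induction rule: finite_ne_induct)
    case (singleton x)
    then show ?case
      using assms(1) by (auto simp: order_on_defs refl_on_def)
  next
    case (insert x F)
    then obtain m where m: "m \<in> F" "\<forall>x\<in>F. (m, x) \<in> r" by blast
    have refl: "(y, y) \<in> r" for y
      using assms(1) by (auto simp: order_on_defs refl_on_def)
    then have "(x, m) \<in> r \<or> (m, x) \<in> r"
      using assms(1) by (cases "x = m") (auto simp: order_on_defs refl_on_def total_on_def)
    with m refl show ?case
      using assms(1) by (auto simp: order_on_defs dest: transD)
  qed
  moreover have "antisym r"
    using assms(1) by (simp add: order_on_defs)
  ultimately have "\<exists>!m. m \<in> A \<and> (\<forall>x\<in>A. (m, x) \<in> r)"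
    by (meson antisymD)
  from theI'[OF this] show ?thesis
    unfolding min_wrt_def by blast
qed

section \<open>Transversals for the scalings of Deuring forms\<close>

context finite_field_1_mod_3
begin

abbreviation iso_rel :: "'a weierstrass rel" where
  "iso_rel \<equiv> {(E, E'). E \<in> cyclic_3_torsion_curves \<and> E' \<in> cyclic_3_torsion_curves
     \<and> isomorphic_curves E E'}"

text \<open>Every class contains a Deuring form with noncube \<open>a^3 - 27 * b\<close>, and
  isomorphisms among these are scalings. It thus suffices that \<open>R\<close> meets each scaling
  orbit exactly once.\<close>

lemma deuring_transversal:
  fixes R :: "'a weierstrass set"
  assumes form: "\<And>E. E \<in> R \<Longrightarrow> \<exists>a b. E = deuring a b \<and> \<not> is_nth_power 3 (a^3 - 27 * b)"
    and ex: "\<And>a b. \<not> is_nth_power 3 (a^3 - 27 * b) \<Longrightarrow>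
      \<exists>v a' b'. v \<noteq> 0 \<and> a = v * a' \<and> b = v^3 * b' \<and> deuring a' b' \<in> R"
    and unique: "\<And>v a b. v \<noteq> 0 \<Longrightarrow> deuring (v * a) (v^3 * b) \<in> R \<Longrightarrow> deuring a b \<in> R
      \<Longrightarrow> v * a = a \<and> v^3 * b = b"
  shows "family_of_representatives R (isomorphism_classes cyclic_3_torsion_curves)"
    and "card (isomorphism_classes (cyclic_3_torsion_curves :: 'a weierstrass set)) = card R"
proof -
  have R: "R \<subseteq> cyclic_3_torsion_curves"
    using form deuring_in_cyclic_3_torsion_curves by blast
  obtain b0 :: 'a where "\<not> is_nth_power 3 b0" using ex_noncube by blast
  note \<omega> = noncube_power_k(2)[OF this]
  have 1: "\<exists>E'\<in>R. (E, E') \<in> iso_rel" if E: "E \<in> cyclic_3_torsion_curves" for E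
  proof -
    obtain a b where ab: "\<not> is_nth_power 3 (a^3 - 27 * b)" "isomorphic_curves E (deuring a b)"
      using cyclic_3_torsion_curve_deuring[OF \<omega> three_neq_0 E] by blast
    obtain v a' b' where v: "v \<noteq> 0" "a = v * a'" "b = v^3 * b'" and in_R: "deuring a' b' \<in> R"
      using ex[OF ab(1)] by blast
    have "isomorphic_curves E (deuring a' b')"
      using ab(2) isomorphic_deuring_scale[OF v(1), of a' b'] unfolding v(2,3)
      by (rule isomorphic_curves_trans)
    with in_R E R show ?thesis by blast
  qed
  have 2: "E = E'" if E_in: "E \<in> R" "E' \<in> R" and iso: "(E, E') \<in> iso_rel" for E E'
  proof -
    obtain a b a' b' where E: "E = deuring a b" "E' = deuring a' b'"
      and nc: "\<not> is_nth_power 3 (a^3 - 27 * b)" "\<not> is_nth_power 3 (a'^3 - 27 * b')"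
      using form E_in by meson
    obtain u where "u \<noteq> 0" "a = u * a'" "b = u^3 * b'"
      using isomorphic_deuringD[OF nc(1) torsion_group_3_deuring(1)[OF nc(2)], of a'] iso
      by (auto simp: E)
    with unique[of u a' b'] E_in show ?thesis by (simp add: E)
  qed
  show "family_of_representatives R (isomorphism_classes cyclic_3_torsion_curves)"
    unfolding isomorphism_classes_def
    using equiv_isomorphic_curves R 1 2 by (rule family_of_representatives_quotient(1))
  show "card (isomorphism_classes (cyclic_3_torsion_curves :: 'a weierstrass set)) = card R"
    unfolding isomorphism_classes_def
    using equiv_isomorphic_curves R 1 2 by (rule family_of_representatives_quotient(2))
qed

text \<open>Scaling to \<open>a \<in> {0, 1}\<close> gives a transversal that is easier to count than the one of
  the theorem.\<close>

lemma card_isomorphism_classes: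
  "card (isomorphism_classes (cyclic_3_torsion_curves :: 'a weierstrass set)) = 2 * k + 2"
proof -
  obtain b0 :: 'a where b0: "\<not> is_nth_power 3 b0" using ex_noncube by blast
  note b0_nz = noncube_power_k(1)[OF b0]
  define B where "B = {b::'a. \<not> is_nth_power 3 (1 - 27 * b)}"
  \<comment> \<open>If \<open>a \<noteq> 0\<close>, scaling makes \<open>a = 1\<close>. If
    \<open>a = 0\<close>, then \<open>b\<close> is a noncube because \<open>- 27 = (- 3)^3\<close>,
    and \<open>b0\<close>, \<open>b0^2\<close> represent the noncubes modulo cubes.\<close>
  define R where "R = deuring 1 ` B \<union> deuring 0 ` {b0, b0^2}"
  have m3: "(-3::'a) \<noteq> 0" using three_neq_0 by simp
  have noncube27: "\<not> is_nth_power 3 (0^3 - 27 * x) \<longleftrightarrow> \<not> is_nth_power 3 x" for x :: 'a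
    using is_cube_mult_cube[OF m3, of x] by simp
  have "card (isomorphism_classes (cyclic_3_torsion_curves :: 'a weierstrass set)) = card R"
  proof (rule deuring_transversal(2))
    fix E assume "E \<in> R"
    then show "\<exists>a b. E = deuring a b \<and> \<not> is_nth_power 3 (a^3 - 27 * b)"
      using b0 noncube_powers[OF b0] noncube27 unfolding R_def B_def by fastforce
  next
    fix a b :: 'a assume nc: "\<not> is_nth_power 3 (a^3 - 27 * b)"
    show "\<exists>v a' b'. v \<noteq> 0 \<and> a = v * a' \<and> b = v^3 * b' \<and> deuring a' b' \<in> R"
    proof (cases "a = 0")
      case True
      with nc noncube27 have b: "\<not> is_nth_power 3 b" by auto
      then obtain i :: nat and u where iu: "i \<in> {0, 1, 2}" "u \<noteq> 0" "b = u^3 * b0 ^ i"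
        using cube_class_exists[OF b0] by (metis is_nth_power_0 zero_less_numeral)
      with b have "i \<noteq> 0" by auto
      with iu True show ?thesis
        by (intro exI[of _ u] exI[of _ 0] exI[of _ "b0 ^ i"]) (auto simp: R_def)
    next
      case False
      have "a^3 - 27 * b = a^3 * (1 - 27 * (b / a^3))"
        using False by (simp add: field_simps)
      with nc have "b / a^3 \<in> B"
        using is_cube_mult_cube[OF False] by (simp add: B_def)
      with False show ?thesis
        by (intro exI[of _ a] exI[of _ 1] exI[of _ "b / a^3"]) (auto simp: R_def)
    qed
  next
    fix v a b :: 'a
    assume v: "v \<noteq> 0" and R1: "deuring (v * a) (v^3 * b) \<in> R" and R2: "deuring a b \<in> R"
    show "v * a = a \<and> v^3 * b = b"
    proof (cases "a = 0")
      case True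
      then have "b \<in> {b0, b0^2}" "v^3 * b \<in> {b0, b0^2}"
        using R1 R2 unfolding R_def by auto
      moreover have "\<exists>i\<in>{1, 2::nat}. x = b0 ^ i" if "x \<in> {b0, b0^2}" for x
        using that by auto
      ultimately obtain i j :: nat
        where "i \<in> {1, 2}" "j \<in> {1, 2}" "b = b0 ^ j" "v^3 * b = b0 ^ i"
        by blast
      then show ?thesis
        using cube_class_unique[OF b0 v, of i j] True by auto
    next
      case False
      with R2 have "a = 1" by (auto simp: R_def)
      with R1 v have "v = 1" by (auto simp: R_def)
      then show ?thesis by simp
    qed
  qed
  also have "card R = card (deuring 1 ` B) + card (deuring 0 ` {b0, b0^2})"
    unfolding R_def by (rule card_Un_disjoint) auto
  also have "card (deuring 1 ` B) = card B"
    by (rule card_image) (auto intro: inj_onI)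
  also have "card B = card {x::'a. \<not> is_nth_power 3 x}"
  proof (rule bij_betw_same_card)
    have "(27::'a) = 3^3" by simp
    with three_neq_0 have "(27::'a) \<noteq> 0" by (metis power_eq_0_iff)
    then show "bij_betw (\<lambda>b. 1 - 27 * b) B {x. \<not> is_nth_power 3 x}"
      by (intro bij_betw_byWitness[of _ "\<lambda>x. (1 - x) / 27"]) (auto simp: B_def diff_divide_distrib)
  qed
  also have "\<dots> = 2 * k" by (rule card_noncubes)
  also have "card (deuring 0 ` {b0, b0^2}) = 2"
  proof -
    have "b0 \<noteq> b0^2"
      using b0_nz b0 by (auto simp: power2_eq_square)
    then show ?thesis by simp
  qed
  finally show ?thesis .
qed

text \<open>Scaling first brings \<open>b\<close> to some \<open>b0 ^ i\<close>. The scalings that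
  remain are by cube roots of unity; they permute \<open>{a, \<rho> * a, \<rho>^2 * a}\<close>,
  where the minimum selects one element.\<close>

lemma family_of_representatives_min_wrt:
  fixes b0 \<rho> :: 'a and r :: "'a rel"
  assumes b0: "\<not> is_nth_power 3 b0" and \<rho>: "primitive_root_of_unity 3 \<rho>"
    and r: "linear_order r"
  shows "family_of_representatives
           {Weierstrass (min_wrt r {a, \<rho> * a, \<rho>^2 * a}) 0 (b0 ^ i) 0 0 | (i::nat) (a::'a).
              i \<in> {0, 1, 2} \<and> \<not> is_nth_power 3 (a^3 - 27 * b0 ^ i)}
           (isomorphism_classes cyclic_3_torsion_curves)"
    (is "family_of_representatives ?R _")
proof -
  define orbit where "orbit a = {a, \<rho> * a, \<rho>^2 * a}" for a
  define m where "m a = min_wrt r (orbit a)" for a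
  have \<rho>3: "\<rho>^3 = 1" and "\<rho> \<noteq> 1"
    using \<rho> by (force simp: primitive_root_of_unity_def)+
  then have \<rho>2: "\<rho>^2 + \<rho> + 1 = 0"
    using cube_root_of_unity by blast
  have orbit: "orbit a = {v * a | v. v^3 = 1}" for a
    unfolding cube_eq_1_iff[OF \<rho>2] by (auto simp: orbit_def)
  have orbit_eq: "orbit (v * a) = orbit a" if v: "v^3 = 1" for v a
  proof -
    have "v \<noteq> 0" using v by auto
    have "\<exists>w'. w * (v * a) = w' * a \<and> w'^3 = 1" if "w^3 = 1" for w
      using v that by (intro exI[of _ "w * v"]) (simp add: power_mult_distrib)
    moreover have "\<exists>w'. w * a = w' * (v * a) \<and> w'^3 = 1" if "w^3 = 1" for w
      using v that \<open>v \<noteq> 0\<close> by (intro exI[of _ "w / v"]) (simp add: power_divide)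
    ultimately show ?thesis unfolding orbit by blast
  qed
  have "m a \<in> orbit a" for a
    unfolding m_def by (rule min_wrt_in[OF r]) (auto simp: orbit_def)
  then have m: "\<exists>v. v^3 = 1 \<and> m a = v * a" for a
    unfolding orbit by blast
  \<comment> \<open>Passing to the minimum therefore leaves the noncube condition unchanged.\<close>
  have m_cube: "(m a)^3 = a^3" for a
    using m[of a] by (auto simp: power_mult_distrib)
  have R: "?R = {deuring (m a) (b0 ^ i) | i a. i \<in> {0, 1, 2::nat} \<and> \<not> is_nth_power 3 (a^3 - 27 * b0 ^ i)}"
    by (simp add: m_def orbit_def)
  show ?thesis
    unfolding R
  proof (rule deuring_transversal(1))
    fix E assume "E \<in> {deuring (m a) (b0 ^ i) | i a. i \<in> {0, 1, 2::nat} \<and> \<not> is_nth_power 3 (a^3 - 27 * b0 ^ i)}"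
    then obtain i a where "E = deuring (m a) (b0 ^ i)" "\<not> is_nth_power 3 (a^3 - 27 * b0 ^ i)"
      by blast
    then show "\<exists>a b. E = deuring a b \<and> \<not> is_nth_power 3 (a^3 - 27 * b)"
      using m_cube[of a] by metis
  next
    fix a b :: 'a assume nc: "\<not> is_nth_power 3 (a^3 - 27 * b)"
    then have "b \<noteq> 0" by auto
    then obtain i :: nat and u where i: "i \<in> {0, 1, 2}" and u: "u \<noteq> 0" "b = u^3 * b0 ^ i"
      using cube_class_exists[OF b0] by blast
    have "a^3 - 27 * b = u^3 * ((a / u)^3 - 27 * b0 ^ i)"
      using u by (simp add: power_divide field_simps)
    with nc have nc': "\<not> is_nth_power 3 ((a / u)^3 - 27 * b0 ^ i)"
      using is_cube_mult_cube[OF u(1)] by simp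
    obtain v where v: "v^3 = 1" "m (a / u) = v * (a / u)" using m by blast
    then have "v \<noteq> 0" by auto
    show "\<exists>w a' b'. w \<noteq> 0 \<and> a = w * a' \<and> b = w^3 * b' \<and> deuring a' b' \<in>
        {deuring (m a) (b0 ^ i) | i a. i \<in> {0, 1, 2::nat} \<and> \<not> is_nth_power 3 (a^3 - 27 * b0 ^ i)}"
    proof (intro exI conjI)
      \<comment> \<open>The factor \<open>u\<close> normalizes \<open>b\<close>, and
        \<open>v\<close> moves \<open>a / u\<close> to its minimum without affecting
        \<open>b\<close>, since \<open>v^3 = 1\<close>.\<close>
      show "u / v \<noteq> 0" using u \<open>v \<noteq> 0\<close> by simp
      show "a = u / v * m (a / u)" using v u \<open>v \<noteq> 0\<close> by simp
      show "b = (u / v)^3 * b0 ^ i" using v(1) u(2) by (simp add: power_divide)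
      show "deuring (m (a / u)) (b0 ^ i) \<in>
        {deuring (m a) (b0 ^ i) | i a. i \<in> {0, 1, 2::nat} \<and> \<not> is_nth_power 3 (a^3 - 27 * b0 ^ i)}"
        using i nc' by blast
    qed
  next
    fix v a b :: 'a
    assume v: "v \<noteq> 0"
      and R1: "deuring (v * a) (v^3 * b) \<in>
        {deuring (m a) (b0 ^ i) | i a. i \<in> {0, 1, 2::nat} \<and> \<not> is_nth_power 3 (a^3 - 27 * b0 ^ i)}"
      and R2: "deuring a b \<in>
        {deuring (m a) (b0 ^ i) | i a. i \<in> {0, 1, 2::nat} \<and> \<not> is_nth_power 3 (a^3 - 27 * b0 ^ i)}"
    obtain i c where 1: "i \<in> {0, 1, 2}" "v * a = m c" "v^3 * b = b0 ^ i" using R1 by auto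
    obtain j d where 2: "j \<in> {0, 1, 2}" "a = m d" "b = b0 ^ j" using R2 by auto
    have "b0 ^ i = v^3 * b0 ^ j" using 1 2 by simp
    with v 1(1) 2(1) have "i = j" by (intro cube_class_unique[OF b0])
    have v3: "v^3 = 1"
      using 1(3) 2(3) \<open>i = j\<close> noncube_power_k(1)[OF b0] by simp
    \<comment> \<open>The value \<open>m x\<close> lies in the orbit of \<open>x\<close>, so both
      have the same orbit and the same minimum.\<close>
    have m_idem: "m (m x) = m x" for x
      using m[of x] orbit_eq by (auto simp: m_def)
    have "v * a = m (v * a)" by (simp add: 1(2) m_idem)
    also have "\<dots> = m a" using orbit_eq[OF v3] by (simp add: m_def)
    also have "\<dots> = a" by (simp add: 2(2) m_idem)
    finally show "v * a = a \<and> v^3 * b = b" using v3 by simp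
  qed
qed

end

theorem proposition6:
  fixes q :: nat
  assumes "card (UNIV :: 'a::{field,finite} set) = q" and "[q = 1] (mod 3)"
  shows "real (card (isomorphism_classes (cyclic_3_torsion_curves :: 'a weierstrass set)))
           = (2 * real q + 4) / 3
    \<and> (\<forall>(b0::'a) (\<rho>::'a) (r::'a rel).
         \<not> is_nth_power 3 b0 \<longrightarrow> primitive_root_of_unity 3 \<rho> \<longrightarrow> linear_order r \<longrightarrow>
         family_of_representatives
           {Weierstrass (min_wrt r {a, \<rho> * a, \<rho>^2 * a}) 0 (b0 ^ i) 0 0 | (i::nat) (a::'a).
              i \<in> {0, 1, 2} \<and> \<not> is_nth_power 3 (a^3 - 27 * b0 ^ i)}
           (isomorphism_classes cyclic_3_torsion_curves))"
proof -
  have "q mod 3 = 1" using assms(2) by (simp add: cong_def)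
  then have q: "q = 3 * (q div 3) + 1" by presburger
  interpret finite_field_1_mod_3 "q div 3" "TYPE('a)"
    using assms(1) q by unfold_locales simp
  have "real q = 3 * real (q div 3) + 1"
    by (subst q) simp
  then have "real (card (isomorphism_classes (cyclic_3_torsion_curves :: 'a weierstrass set)))
      = (2 * real q + 4) / 3"
    unfolding card_isomorphism_classes by simp
  with family_of_representatives_min_wrt show ?thesis by blast
qed

end
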